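(* Let $c\ge1$ and $d\ge0$ be integers and let $S_n=\{x_1,\dots,x_n\}$ be a set of $n$ distinct positive integers. Let $f_1,\dots,f_c\in\mathcal{C}_{S_n}$ be distinct and let $(l_1,\dots,l_c)$ be positive integers with $l_1+\dots+l_c>d$. Write $h=f_1^{(l_1)}*\dots*f_c^{(l_c)}*\mu^{(d)}$. Then: (i) $$\prod_{k=1}^n\ \sum_{\substack{d'\mid x_k\\ d'\nmid x_t \text{ for all } x_t<x_k}} (f_1^{(l_1)}*\dots*f_c^{(l_c)}*\mu^{(d+1)})(d')\ \le\ \det\big(h(\gcd(x_i,x_j))\big)_{1\le i,j\le n}\ \le\ \prod_{k=1}^n h(x_k);$$ (ii) the $n\times n$ matrix $\big(h(\gcd(x_i,x_j))\big)_{1\le i,j\le n}$ is positive semi-definite.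
   Context: An arithmetical function is a complex-valued function on the positive integers; $*$ denotes Dirichlet convolution $(f*g)(m)=\sum_{e\mid m}f(e)g(m/e)$, and $\mu$ is the Möbius function. For an arithmetical function $f$, $f^{(0)}=\delta$ (where $\delta(1)=1$, $\delta(m)=0$ for $m>1$) and $f^{(c)}=f^{(c-1)}*f$ for $c\ge1$. For a set $S$ of positive integers, $\mathcal{C}_S$ is the class of arithmetical functions $f$ such that $(f*\mu)(d')\ge0$ (in particular is real) whenever $d'\mid x$ for some $x\in S$. *)

theory Defs
  imports
    "HOL-Computational_Algebra.Squarefree"
    "HOL-Library.Complex_Order"
    "Jordan_Normal_Form.Determinant"
    "Jordan_Normal_Form.Schur_Decomposition"
begin

text \<open>
  An arithmetical function is represented by a function \<open>nat \<Rightarrow> complex\<close> whose value at \<open>0\<close>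
  is irrelevant (at \<open>0\<close> the convolution below sums over the infinite set of all numbers and is
  therefore \<open>0\<close>). The order on complex numbers is that of \<^theory>\<open>HOL-Library.Complex_Order\<close>:
  \<open>a \<le> b\<close> means \<open>Re a \<le> Re b\<close> and \<open>Im a = Im b\<close>; in particular \<open>0 \<le> a\<close> entails that \<open>a\<close> is real.
\<close>

definition dconv :: "(nat \<Rightarrow> complex) \<Rightarrow> (nat \<Rightarrow> complex) \<Rightarrow> nat \<Rightarrow> complex" (infixl \<open>\<star>\<close> 70)
  where "(f \<star> g) m = (\<Sum>e | e dvd m. f e * g (m div e))"

definition dconv_one :: "nat \<Rightarrow> complex"
  where "dconv_one m = (if m = 1 then 1 else 0)"

primrec dconv_pow :: "(nat \<Rightarrow> complex) \<Rightarrow> nat \<Rightarrow> nat \<Rightarrow> complex"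
  where
    "dconv_pow f 0 = dconv_one"
  | "dconv_pow f (Suc c) = dconv_pow f c \<star> f"

text \<open>\<open>dconv_prod F c\<close> is \<open>F 0 \<star> \<dots> \<star> F (c - 1)\<close>.\<close>

primrec dconv_prod :: "(nat \<Rightarrow> nat \<Rightarrow> complex) \<Rightarrow> nat \<Rightarrow> nat \<Rightarrow> complex"
  where
    "dconv_prod F 0 = dconv_one"
  | "dconv_prod F (Suc c) = dconv_prod F c \<star> F c"

definition moebius :: "nat \<Rightarrow> complex"
  where "moebius m = (if squarefree m then (- 1) ^ card (prime_factors m) else 0)"

definition class_C :: "nat set \<Rightarrow> (nat \<Rightarrow> complex) set"
  where "class_C S = {f. \<forall>x\<in>S. \<forall>e. e dvd x \<longrightarrow> 0 \<le> (f \<star> moebius) e}"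

text \<open>Equality as functions on the positive integers, i.e. ignoring the value at \<open>0\<close>.\<close>

definition arith_eq :: "(nat \<Rightarrow> complex) \<Rightarrow> (nat \<Rightarrow> complex) \<Rightarrow> bool"
  where "arith_eq f g \<longleftrightarrow> (\<forall>m>0. f m = g m)"

definition gcd_mat :: "(nat \<Rightarrow> complex) \<Rightarrow> nat \<Rightarrow> (nat \<Rightarrow> nat) \<Rightarrow> complex mat"
  where "gcd_mat h n x = mat n n (\<lambda>(i, j). h (gcd (x i) (x j)))"

definition psd_mat :: "complex mat \<Rightarrow> bool"
  where "psd_mat A \<longleftrightarrow>
    square_mat A \<and> mat_adjoint A = A \<and>
    (\<forall>v \<in> carrier_vec (dim_row A). 0 \<le> (A *\<^sub>v v) \<bullet>c v)"

end

theory Submission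
  imports Defs
begin

text \<open>
  With \<open>g = h \<star> \<mu>\<close>, Moebius inversion turns the gcd matrix into a Gram matrix
  \<open>\<Sum>e. g e * v\<^sub>e * v\<^sub>e\<^sup>T\<close>, where \<open>v\<^sub>e\<close> records which \<open>x\<^sub>i\<close> are divisible by \<open>e\<close>. Since there are
  at least \<open>d + 1\<close> factors \<open>f\<^sub>i\<close>, each factor \<open>\<mu>\<close> of \<open>g\<close> can be paired with one of them, so the
  weights \<open>g e\<close> are nonnegative. After sorting the \<open>x\<^sub>i\<close> increasingly, the determinant is the
  product of the Schur complements of the leading blocks. The \<open>k\<close>-th one is the minimum of the
  quadratic form over vectors with \<open>k\<close>-th entry \<open>1\<close> and no later entries: it is at most the
  diagonal entry, and at least the total weight of those \<open>e\<close> for which \<open>v\<^sub>e\<close> vanishes before \<open>k\<close>.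
  If a leading block is singular, the determinant and the lower bound are both \<open>0\<close>.
\<close>

section \<open>The algebra of Dirichlet convolution\<close>

lemma dconv_0 [simp]: "(f \<star> g) 0 = 0"
  by (simp add: dconv_def)

lemma dconv_eq_sum_pairs:
  assumes "m > 0"
  shows "(f \<star> g) m = (\<Sum>(a, b) | a * b = m. f a * g b)"
  unfolding dconv_def using assms
  by (intro sum.reindex_bij_witness[of _ fst "\<lambda>e. (e, m div e)"]) auto

lemma dconv_commute: "f \<star> g = g \<star> f"
proof
  fix m show "(f \<star> g) m = (g \<star> f) m"
  proof (cases "m = 0")
    case False
    then show ?thesis
      by (simp add: dconv_eq_sum_pairs,
          intro sum.reindex_bij_witness[of _ prod.swap prod.swap]) (auto simp: mult.commute)
  qed simp
qed

lemma finite_factor_pairs: "m > 0 \<Longrightarrow> finite {(a, b). a * b = (m :: nat)}"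
  by (rule finite_subset[of _ "{..m} \<times> {..m}"]) auto

lemma dconv_assoc: "(f \<star> g) \<star> k = f \<star> (g \<star> k)"
proof
  fix m show "((f \<star> g) \<star> k) m = (f \<star> (g \<star> k)) m"
  proof (cases "m = 0")
    case False
    have "((f \<star> g) \<star> k) m =
        (\<Sum>p | fst p * snd p = m. \<Sum>q | fst q * snd q = fst p. f (fst q) * g (snd q) * k (snd p))"
      using False
      by (auto simp: dconv_eq_sum_pairs case_prod_unfold sum_distrib_right intro!: sum.cong)
    also have "\<dots> = (\<Sum>(p, q) \<in> (SIGMA p:{p. fst p * snd p = m}. {q. fst q * snd q = fst p}).
        f (fst q) * g (snd q) * k (snd p))"
      using False finite_factor_pairs
      by (intro sum.Sigma) (auto simp: case_prod_unfold)
    \<comment> \<open>Both index sets encode the factorisations m = a b c: the left one as p = (ab,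
      c), q = (a, b), the right one as p = (a, bc), q = (b, c). The two witnesses rebracket.\<close>
    also have "\<dots> = (\<Sum>(p, q) \<in> (SIGMA p:{p. fst p * snd p = m}. {q. fst q * snd q = snd p}).
        f (fst p) * (g (fst q) * k (snd q)))"
      by (intro sum.reindex_bij_witness
          [of _ "\<lambda>(p, q). ((fst p * fst q, snd q), (fst p, fst q))"
              "\<lambda>(p, q). ((fst q, snd q * snd p), (snd q, snd p))"])
         (auto simp: mult_ac)
    also have "\<dots> =
        (\<Sum>p | fst p * snd p = m. \<Sum>q | fst q * snd q = snd p. f (fst p) * (g (fst q) * k (snd q)))"
      using False finite_factor_pairs
      by (intro sum.Sigma[symmetric]) (auto simp: case_prod_unfold)
    also have "\<dots> = (f \<star> (g \<star> k)) m"
      using False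
      by (auto simp: dconv_eq_sum_pairs case_prod_unfold sum_distrib_left intro!: sum.cong)
    finally show ?thesis .
  qed simp
qed

lemma dconv_left_commute: "f \<star> (g \<star> k) = g \<star> (f \<star> k)"
  by (metis dconv_assoc dconv_commute)

lemmas dconv_ac = dconv_assoc dconv_commute dconv_left_commute

lemma dconv_one_right: "m > 0 \<Longrightarrow> (f \<star> dconv_one) m = f m"
proof -
  assume m: "m > 0"
  have "(f \<star> dconv_one) m = (\<Sum>e | e dvd m. if e = m then f e else 0)"
    unfolding dconv_def by (rule sum.cong) (use m in \<open>auto simp: dconv_one_def\<close>)
  also have "\<dots> = f m" using m by (simp add: sum.delta)
  finally show ?thesis .
qed

text \<open>Convolution never reads its arguments at \<open>0\<close>: for positive \<open>m\<close>
  all divisors and cofactors are positive, and at \<open>m = 0\<close> both sides are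
  \<open>0\<close>. Hence agreement off \<open>0\<close> gives full equality of functions, which
  allows rewriting.\<close>

lemma dconv_cong:
  assumes "\<And>m. m > 0 \<Longrightarrow> f m = f' m" and "\<And>m. m > 0 \<Longrightarrow> g m = g' m"
  shows "f \<star> g = f' \<star> g'"
proof
  fix m show "(f \<star> g) m = (f' \<star> g') m"
    by (cases "m = 0") (auto simp: dconv_def intro!: sum.cong arg_cong2[of _ _ _ _ "(*)"] assms
      elim!: dvdE)
qed

lemma dconv_one_assoc: "(f \<star> dconv_one) \<star> g = f \<star> g"
  by (rule dconv_cong) (simp_all add: dconv_one_right)

lemma dconv_pow_0 [simp]: "dconv_pow f a 0 = 0"
  by (cases a) (simp_all add: dconv_one_def)

lemma dconv_pow_add: "dconv_pow f (a + b) = dconv_pow f a \<star> dconv_pow f b"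
proof (induction b)
  case 0
  show ?case
  proof
    fix m show "dconv_pow f (a + 0) m = (dconv_pow f a \<star> dconv_pow f 0) m"
      by (cases "m = 0") (simp_all add: dconv_one_right)
  qed
qed (simp add: dconv_assoc)

section \<open>The Moebius function and Moebius inversion\<close>

lemma moebius_mult_prime:
  assumes "prime p" and "\<not> p dvd e"
  shows "moebius (p * e) = - moebius e"
proof -
  have cop: "coprime p e"
    using assms by (simp add: prime_imp_coprime)
  have "e \<noteq> 0" using assms by (intro notI) simp
  then have pf: "prime_factors (p * e) = insert p (prime_factors e)"
    using assms by (simp add: prime_factors_product prime_prime_factors)
  have "p \<notin> prime_factors e" using assms by auto
  moreover have "squarefree (p * e) \<longleftrightarrow> squarefree e"
    using assms cop squarefree_mult_coprime squarefree_prime squarefree_multD(2) by blast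
  ultimately show ?thesis
    using pf by (simp add: moebius_def)
qed

text \<open>For \<open>m\<close> other than 1 fix a prime p dividing \<open>m\<close>. Only
  squarefree divisors contribute, and they split into pairs e, p e with p not dividing e; the two
  values in each pair cancel.\<close>

lemma sum_moebius: "m > 0 \<Longrightarrow> (\<Sum>e | e dvd m. moebius e) = dconv_one m"
proof (cases "m = 1")
  case True
  then show ?thesis by (simp add: moebius_def dconv_one_def)
next
  case False
  assume m: "m > 0"
  obtain p where p: "prime p" "p dvd m" using False prime_factor_nat by blast
  let ?N = "{e. e dvd m \<and> \<not> p dvd e \<and> squarefree e}"
  let ?D = "{e. e dvd m \<and> squarefree e}"
  have fin: "finite {e. e dvd m}" using m by simp
  have D: "?D = ?N \<union> (*) p ` ?N"
  proof (intro subset_antisym subsetI)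
    fix e assume e: "e \<in> ?D"
    show "e \<in> ?N \<union> (*) p ` ?N"
    proof (cases "p dvd e")
      case True
      then obtain a where a: "e = p * a" by blast
      have sq: "squarefree (p * a)" using e a by simp
      have "\<not> p dvd a"
      proof
        assume "p dvd a"
        then have "p ^ 2 dvd p * a" by (simp add: power2_eq_square)
        with sq have "p dvd 1" by (rule squarefreeD)
        with p show False by simp
      qed
      moreover have "squarefree a" using sq by (rule squarefree_multD)
      moreover have "a dvd m" using e a by (auto dest: dvd_mult_right)
      ultimately show ?thesis using a by auto
    qed (use e in auto)
  next
    fix e assume "e \<in> ?N \<union> (*) p ` ?N"
    then show "e \<in> ?D"
    proof
      assume "e \<in> (*) p ` ?N"
      then obtain a where a: "e = p * a" "a \<in> ?N" by blast
      then have "coprime p a" using p by (simp add: prime_imp_coprime)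
      then show ?thesis using a p
        by (auto simp: squarefree_mult_coprime squarefree_prime divides_mult)
    qed auto
  qed
  have "(\<Sum>e | e dvd m. moebius e) = (\<Sum>e\<in>?D. moebius e)"
    by (rule sum.mono_neutral_right[OF fin]) (auto simp: moebius_def)
  also have "\<dots> = (\<Sum>e\<in>?N. moebius e) + (\<Sum>e\<in>(*) p ` ?N. moebius e)"
    unfolding D by (rule sum.union_disjoint) (use fin in auto)
  also have "(\<Sum>e\<in>(*) p ` ?N. moebius e) = (\<Sum>e\<in>?N. - moebius e)"
    using p by (subst sum.reindex) (auto simp: inj_on_def moebius_mult_prime intro!: sum.cong)
  finally show ?thesis using False by (simp add: sum_negf dconv_one_def)
qed

text \<open>Moebius inversion: summing over divisors is convolution with the constant function 1,
  and this function is the convolution inverse of \<open>moebius\<close>.\<close>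

lemma sum_dconv_moebius: "m > 0 \<Longrightarrow> (\<Sum>e | e dvd m. (f \<star> moebius) e) = f m"
proof -
  assume m: "m > 0"
  have one: "(g \<star> (\<lambda>_. 1)) k = (\<Sum>e | e dvd k. g e)" for g k
    by (simp add: dconv_def)
  have "(\<Sum>e | e dvd m. (f \<star> moebius) e) = (f \<star> (moebius \<star> (\<lambda>_. 1))) m"
    by (simp only: one[symmetric] dconv_assoc)
  also have "f \<star> (moebius \<star> (\<lambda>_. 1)) = f \<star> dconv_one"
    by (rule dconv_cong) (simp_all only: one sum_moebius)
  finally show ?thesis using m by (simp add: dconv_one_right)
qed

section \<open>Nonnegativity after convolution with powers of \<mu>\<close>

text \<open>\<open>L\<close> is a capacity: the number of factors \<mu> that \<open>G\<close> can
  absorb while staying nonnegative on \<open>D\<close>. All smaller powers are included so that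
  capacities add under convolution.\<close>

definition moebius_nonneg :: "nat set \<Rightarrow> nat \<Rightarrow> (nat \<Rightarrow> complex) \<Rightarrow> bool"
  where "moebius_nonneg D L G \<longleftrightarrow> (\<forall>j\<le>L. \<forall>e\<in>D. 0 \<le> (G \<star> dconv_pow moebius j) e)"

lemma moebius_nonneg_dconv:
  assumes D: "\<forall>e\<in>D. \<forall>a. a dvd e \<longrightarrow> a \<in> D"
    and G: "moebius_nonneg D L G" and H: "moebius_nonneg D M H"
  shows "moebius_nonneg D (L + M) (G \<star> H)"
  unfolding moebius_nonneg_def
proof (intro allI impI ballI)
  fix j e assume j: "j \<le> L + M" and e: "e \<in> D"
  \<comment> \<open>Hand \<open>G\<close> as many factors \<mu> as its capacity allows; the
    remaining \<open>b\<close> then fit into the capacity of \<open>H\<close>.\<close>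
  define a where "a = min j L"
  define b where "b = j - a"
  have ab: "j = a + b" "a \<le> L" "b \<le> M" using j by (auto simp: a_def b_def)
  have "(G \<star> H) \<star> dconv_pow moebius j
      = (G \<star> dconv_pow moebius a) \<star> (H \<star> dconv_pow moebius b)"
    by (simp add: ab(1) dconv_pow_add dconv_ac)
  moreover have "0 \<le> ((G \<star> dconv_pow moebius a) \<star> (H \<star> dconv_pow moebius b)) e"
    unfolding dconv_def[of "G \<star> _"]
  proof (intro sum_nonneg mult_nonneg_nonneg)
    fix r assume "r \<in> {r. r dvd e}"
    then have r: "r dvd e" by simp
    then show "0 \<le> (G \<star> dconv_pow moebius a) r"
      using G D e ab by (auto simp: moebius_nonneg_def)
    have "e div r dvd e" using r by auto
    then show "0 \<le> (H \<star> dconv_pow moebius b) (e div r)"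
      using H D e ab by (auto simp: moebius_nonneg_def)
  qed
  ultimately show "0 \<le> ((G \<star> H) \<star> dconv_pow moebius j) e" by simp
qed

lemma moebius_nonneg_one: "moebius_nonneg D 0 dconv_one"
proof -
  have "0 \<le> (dconv_one \<star> dconv_one) e" for e
    by (cases "e = 0") (simp_all add: dconv_one_right dconv_one_def less_eq_complex_def)
  then show ?thesis by (simp add: moebius_nonneg_def)
qed

text \<open>Each class member has capacity 1: for \<open>j = 1\<close> this is the defining
  condition, and for \<open>j = 0\<close> Moebius inversion writes the value at \<open>e\<close> as
  a sum of nonnegative values at divisors of \<open>e\<close>.\<close>

lemma moebius_nonneg_class_C:
  assumes f: "f \<in> class_C S" and S: "0 \<notin> S"
  shows "moebius_nonneg {e. \<exists>x\<in>S. e dvd x} 1 f"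
  unfolding moebius_nonneg_def
proof (intro allI impI ballI)
  fix j e assume j: "j \<le> (1 :: nat)" and e: "e \<in> {e. \<exists>x\<in>S. e dvd x}"
  have pos: "e > 0" using e S by (auto intro!: Nat.gr0I)
  show "0 \<le> (f \<star> dconv_pow moebius j) e"
  proof (cases "j = 0")
    case True
    have "0 \<le> (\<Sum>a | a dvd e. (f \<star> moebius) a)"
      using f e by (intro sum_nonneg) (auto simp: class_C_def dest: dvd_trans)
    then show ?thesis
      using True pos by (simp add: sum_dconv_moebius dconv_one_right)
  next
    case False
    then have "j = Suc 0" using j by simp
    moreover have "f \<star> (dconv_one \<star> moebius) = f \<star> moebius"
      by (metis dconv_assoc dconv_one_assoc)
    ultimately show ?thesis using f e by (auto simp: class_C_def)
  qed
qed

lemma moebius_nonneg_dconv_pow: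
  assumes "\<forall>e\<in>D. \<forall>a. a dvd e \<longrightarrow> a \<in> D" and "moebius_nonneg D 1 f"
  shows "moebius_nonneg D m (dconv_pow f m)"
proof (induction m)
  case (Suc m)
  then show ?case using moebius_nonneg_dconv[OF assms(1) Suc assms(2)] by simp
qed (simp add: moebius_nonneg_one)

lemma moebius_nonneg_dconv_prod:
  assumes "\<forall>e\<in>D. \<forall>a. a dvd e \<longrightarrow> a \<in> D"
    and "\<And>i. i < c \<Longrightarrow> moebius_nonneg D (l i) (G i)"
  shows "moebius_nonneg D (\<Sum>i<c. l i) (dconv_prod G c)"
  using assms(2)
proof (induction c)
  case (Suc c)
  then have "moebius_nonneg D (\<Sum>i<c. l i) (dconv_prod G c)" by simp
  from moebius_nonneg_dconv[OF assms(1) this Suc.prems[of c]] show ?case by simp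
qed (simp add: moebius_nonneg_one)

section \<open>Determinant bounds for nonnegatively weighted Gram matrices\<close>

text \<open>The size \<open>n\<close> is separate from the infinite sequences \<open>u e\<close>, so
  the leading blocks are weighted Gram matrices of the same data and induction on \<open>n\<close>
  applies.\<close>

definition weighted_gram :: "'e set \<Rightarrow> ('e \<Rightarrow> real) \<Rightarrow> ('e \<Rightarrow> nat \<Rightarrow> real) \<Rightarrow> nat \<Rightarrow> real mat"
  where "weighted_gram E w u n = mat n n (\<lambda>(i, j). \<Sum>e\<in>E. w e * u e i * u e j)"

lemma weighted_gram_carrier [simp]: "weighted_gram E w u n \<in> carrier_mat n n"
  by (simp add: weighted_gram_def)

lemma weighted_gram_mult_row:
  "(\<Sum>j\<in>J. (\<Sum>e\<in>E. w e * u e i * u e j) * v j) = (\<Sum>e\<in>E. w e * u e i * (\<Sum>j\<in>J. u e j * v j))"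
  for w :: "'e \<Rightarrow> real"
  unfolding sum_distrib_right sum_distrib_left
  by (subst sum.swap) (simp add: mult_ac)

text \<open>A kernel vector of the leading block, padded by a final \<open>0\<close>, is a kernel
  vector of the larger matrix.\<close>

lemma det_weighted_gram_Suc_eq_0:
  assumes fin: "finite E" and w: "\<And>e. e \<in> E \<Longrightarrow> w e \<ge> 0"
    and det0: "det (weighted_gram E w u n) = 0"
  shows "det (weighted_gram E w u (Suc n)) = 0"
proof -
  obtain v where v: "v \<in> carrier_vec n" "v \<noteq> 0\<^sub>v n" and Av: "weighted_gram E w u n *\<^sub>v v = 0\<^sub>v n"
    using det0 det_0_iff_vec_prod_zero[OF weighted_gram_carrier] by blast
  define q where "q e = (\<Sum>j<n. u e j * v $ j)" for e
  have row: "(\<Sum>e\<in>E. w e * u e i * q e) = 0" if i: "i < n" for i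
  proof -
    have "(weighted_gram E w u n *\<^sub>v v) $ i = (\<Sum>e\<in>E. w e * u e i * q e)"
      using i v(1) weighted_gram_mult_row[where J = "{..<n}" and v = "\<lambda>j. v $ j"]
      by (simp add: weighted_gram_def scalar_prod_def q_def atLeast0LessThan)
    then show ?thesis using Av i by simp
  qed
  \<comment> \<open>This is the quadratic form at \<open>v\<close>. It vanishes, and all its terms
    are nonnegative, so each term is zero.\<close>
  have "(\<Sum>e\<in>E. w e * (q e)\<^sup>2) = (\<Sum>i<n. v $ i * (\<Sum>e\<in>E. w e * u e i * q e))"
    unfolding sum_distrib_left
    by (subst sum.swap) (simp add: q_def power2_eq_square sum_distrib_left sum_distrib_right mult_ac)
  also have "\<dots> = 0" using row by simp
  finally have "\<forall>e\<in>E. w e * (q e)\<^sup>2 = 0"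
    using fin w by (subst (asm) sum_nonneg_eq_0_iff) auto
  \<comment> \<open>A weight may be zero, so only the product vanishes; that suffices, because every
    row of the larger matrix, including the new one, pairs with \<open>v'\<close> to a combination
    of these products.\<close>
  then have wq: "w e * q e = 0" if "e \<in> E" for e using that by auto
  define v' where "v' = vec (Suc n) (\<lambda>j. if j < n then v $ j else 0)"
  have "weighted_gram E w u (Suc n) *\<^sub>v v' = 0\<^sub>v (Suc n)"
  proof (intro eq_vecI)
    fix i assume "i < dim_vec (0\<^sub>v (Suc n) :: real vec)"
    then have i: "i < Suc n" by simp
    have "(weighted_gram E w u (Suc n) *\<^sub>v v') $ i
        = (\<Sum>j<n. (\<Sum>e\<in>E. w e * u e i * u e j) * v $ j)"
      using i by (simp add: weighted_gram_def v'_def scalar_prod_def atLeast0LessThan)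
    also have "\<dots> = (\<Sum>e\<in>E. u e i * (w e * q e))"
      unfolding weighted_gram_mult_row by (simp add: q_def mult_ac)
    also have "\<dots> = 0" using wq by simp
    finally show "(weighted_gram E w u (Suc n) *\<^sub>v v') $ i = 0\<^sub>v (Suc n) $ i" using i by simp
  qed (simp add: weighted_gram_def)
  moreover have "v' \<noteq> 0\<^sub>v (Suc n)"
  proof
    assume z: "v' = 0\<^sub>v (Suc n)"
    have "v $ j = 0" if "j < n" for j
      using arg_cong[OF z, of "\<lambda>t. t $ j"] that by (simp add: v'_def)
    with v show False by (auto intro!: eq_vecI)
  qed
  moreover have "v' \<in> carrier_vec (Suc n)" by (simp add: v'_def)
  ultimately show ?thesis
    using det_0_iff_vec_prod_zero[OF weighted_gram_carrier] by blast
qed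

text \<open>Multiply on the right by the identity matrix with last column replaced by
  \<open>v\<close>. It has determinant 1, and the product has a last column that is zero above its
  bottom entry; expand along that column.\<close>

lemma det_last_column_elimination:
  fixes A :: "'a :: comm_ring_1 mat"
  assumes A: "A \<in> carrier_mat (Suc n) (Suc n)" and v: "v n = 1"
    and row: "\<And>i. i < n \<Longrightarrow> (\<Sum>j\<le>n. A $$ (i, j) * v j) = 0"
  shows "det A = det (mat n n (\<lambda>(i, j). A $$ (i, j))) * (\<Sum>j\<le>n. A $$ (n, j) * v j)"
proof -
  define M where "M = mat (Suc n) (Suc n) (\<lambda>(i, j). if j = n then v i else if i = j then 1 else 0)"
  have M: "M \<in> carrier_mat (Suc n) (Suc n)" by (simp add: M_def)
  have "upper_triangular M" by (auto simp: M_def upper_triangular_def)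
  then have detM: "det M = 1"
    using det_upper_triangular[OF _ M] by (simp add: prod_list_diag_prod M_def v)
  have AM: "(A * M) $$ (i, j) = (if j = n then \<Sum>j\<le>n. A $$ (i, j) * v j else A $$ (i, j))"
    if "i < Suc n" "j < Suc n" for i j
  proof -
    have "(A * M) $$ (i, j) = (\<Sum>k<Suc n. A $$ (i, k) * M $$ (k, j))"
      using that A M by (simp add: scalar_prod_def atLeast0LessThan)
    also have "\<dots> = (\<Sum>k<Suc n. if j = n then A $$ (i, k) * v k else if k = j then A $$ (i, k) else 0)"
      using that by (intro sum.cong) (auto simp: M_def)
    also have "\<dots> = (if j = n then \<Sum>j\<le>n. A $$ (i, j) * v j else A $$ (i, j))"
      using that by (auto simp: lessThan_Suc_atMost)
    finally show ?thesis .
  qed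
  have cAM: "A * M \<in> carrier_mat (Suc n) (Suc n)" using A M by simp
  have "det A = det (A * M)" using det_mult[OF A M] detM by simp
  also have "\<dots> = (\<Sum>i<Suc n. (A * M) $$ (i, n) * cofactor (A * M) i n)"
    using laplace_expansion_column[OF cAM] by simp
  also have "\<dots> = (\<Sum>j\<le>n. A $$ (n, j) * v j) * cofactor (A * M) n n"
    using AM row by (simp del: index_mult_mat)
  also have "cofactor (A * M) n n = det (mat_delete (A * M) n n)"
    by (simp add: cofactor_def)
  also have "mat_delete (A * M) n n = mat n n (\<lambda>(i, j). A $$ (i, j))"
    using A M AM by (intro eq_matI) (auto simp: mat_delete_def simp del: index_mult_mat(1))
  finally show ?thesis by (simp add: mult.commute)
qed

text \<open>Cramer's rule: apply the adjugate to \<open>b\<close> divided by the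
  determinant.\<close>

lemma linear_system_solvable:
  fixes A :: "'a :: field mat"
  assumes A: "A \<in> carrier_mat n n" and "det A \<noteq> 0"
  obtains v where "\<And>i. i < n \<Longrightarrow> (\<Sum>j<n. A $$ (i, j) * v j) = b i"
proof -
  define t where "t = vec n (\<lambda>i. b i / det A)"
  define s where "s = adj_mat A *\<^sub>v t"
  have s: "s \<in> carrier_vec n" using adj_mat(1)[OF A] by (simp add: s_def t_def)
  have "A *\<^sub>v s = (A * adj_mat A) *\<^sub>v t"
    unfolding s_def using A adj_mat(1)[OF A] by (simp add: t_def)
  also have "\<dots> = vec n b"
    unfolding adj_mat(2)[OF A] using assms(2)
    by (intro eq_vecI) (auto simp: t_def row_smult)
  finally have As: "A *\<^sub>v s = vec n b" .
  show ?thesis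
  proof
    fix i assume i: "i < n"
    have "(\<Sum>j<n. A $$ (i, j) * s $ j) = (A *\<^sub>v s) $ i"
      using i A s by (simp add: scalar_prod_def atLeast0LessThan)
    then show "(\<Sum>j<n. A $$ (i, j) * s $ j) = b i" using As i by simp
  qed
qed

text \<open>Regard each index i as the function sending e to \<open>u e i\<close>, with the inner
  product weighted by \<open>w\<close>. Then \<open>s\<close> is the squared norm of the residual
  \<open>r\<close> of the n-th function after projection onto the span of the earlier ones.\<close>

lemma det_weighted_gram_Suc:
  assumes fin: "finite E" and w: "\<And>e. e \<in> E \<Longrightarrow> w e \<ge> 0"
    and det: "det (weighted_gram E w u n) \<noteq> 0"
  obtains s where "det (weighted_gram E w u (Suc n)) = det (weighted_gram E w u n) * s"
    and "(\<Sum>e | e \<in> E \<and> (\<forall>t<n. u e t = 0). w e * (u e n)\<^sup>2) \<le> s"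
    and "s \<le> (\<Sum>e\<in>E. w e * (u e n)\<^sup>2)"
proof -
  define a where "a i j = (\<Sum>e\<in>E. w e * u e i * u e j)" for i j
  \<comment> \<open>Chosen so that \<open>v\<close>, the extension of \<open>v0\<close> by a final
    entry 1, is annihilated by the first \<open>n\<close> rows.\<close>
  obtain v0 where v0: "\<And>i. i < n \<Longrightarrow> (\<Sum>j<n. a i j * v0 j) = - a i n"
    using linear_system_solvable[OF weighted_gram_carrier det, of "\<lambda>i. - a i n"]
    by (auto simp: weighted_gram_def a_def)
  define v where "v = v0(n := 1)"
  define r where "r e = (\<Sum>j\<le>n. u e j * v j)" for e
  define q where "q e = (\<Sum>j<n. u e j * v j)" for e
  define s where "s = (\<Sum>e\<in>E. w e * (r e)\<^sup>2)"
  have r: "r e = q e + u e n" for e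
    by (simp add: r_def q_def v_def lessThan_Suc_atMost[symmetric])
  have ar: "(\<Sum>j\<le>n. a i j * v j) = (\<Sum>e\<in>E. w e * u e i * r e)" for i
    unfolding a_def r_def by (rule weighted_gram_mult_row)
  have row: "(\<Sum>j\<le>n. a i j * v j) = 0" if "i < n" for i
    using v0[OF that] by (simp add: v_def lessThan_Suc_atMost[symmetric])
  \<comment> \<open>Orthogonality: \<open>q\<close> is a combination of the first \<open>n\<close>
    functions, and \<open>r\<close> is orthogonal to each of them.\<close>
  have "(\<Sum>e\<in>E. w e * q e * r e) = (\<Sum>i<n. v i * (\<Sum>e\<in>E. w e * u e i * r e))"
    unfolding sum_distrib_left
    by (subst sum.swap) (simp add: q_def sum_distrib_left sum_distrib_right mult_ac)
  also have "\<dots> = 0" using row by (simp add: ar)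
  finally have qr: "(\<Sum>e\<in>E. w e * q e * r e) = 0" .
  have "(\<Sum>j\<le>n. a n j * v j) = s - (\<Sum>e\<in>E. w e * q e * r e)"
    unfolding ar s_def sum_subtractf[symmetric]
    by (rule sum.cong) (auto simp: r power2_eq_square algebra_simps)
  then have an: "(\<Sum>j\<le>n. a n j * v j) = s" using qr by simp
  have "mat n n (\<lambda>(i, j). weighted_gram E w u (Suc n) $$ (i, j)) = weighted_gram E w u n"
    by (intro eq_matI) (auto simp: weighted_gram_def)
  moreover have "weighted_gram E w u (Suc n) $$ (i, j) = a i j" if "i \<le> n" "j \<le> n" for i j
    using that by (simp add: weighted_gram_def a_def)
  ultimately have "det (weighted_gram E w u (Suc n)) = det (weighted_gram E w u n) * s"
    using det_last_column_elimination[OF weighted_gram_carrier, of v n E w u] row an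
    by (simp add: v_def)
  moreover have "(\<Sum>e | e \<in> E \<and> (\<forall>t<n. u e t = 0). w e * (u e n)\<^sup>2) \<le> s"
  proof -
    \<comment> \<open>Where all earlier coordinates vanish, \<open>q e = 0\<close>, so
      \<open>r e\<close> is just \<open>u e n\<close>.\<close>
    have "(\<Sum>e | e \<in> E \<and> (\<forall>t<n. u e t = 0). w e * (u e n)\<^sup>2)
        = (\<Sum>e | e \<in> E \<and> (\<forall>t<n. u e t = 0). w e * (r e)\<^sup>2)"
      by (rule sum.cong) (auto simp: r q_def)
    also have "\<dots> \<le> s"
      unfolding s_def using fin w by (intro sum_mono2) auto
    finally show ?thesis .
  qed
  moreover have "s \<le> (\<Sum>e\<in>E. w e * (u e n)\<^sup>2)"
  proof -
    \<comment> \<open>Pythagoras for \<open>u e n = r e - q e\<close>, whose cross term is zero by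
      \<open>qr\<close>.\<close>
    have "(\<Sum>e\<in>E. w e * (u e n)\<^sup>2) = s + (\<Sum>e\<in>E. w e * (q e)\<^sup>2) - 2 * (\<Sum>e\<in>E. w e * q e * r e)"
      unfolding s_def sum_distrib_left sum.distrib[symmetric] sum_subtractf[symmetric]
      by (rule sum.cong) (auto simp: r power2_eq_square algebra_simps)
    moreover have "0 \<le> (\<Sum>e\<in>E. w e * (q e)\<^sup>2)"
      using w by (intro sum_nonneg) auto
    ultimately show ?thesis using qr by simp
  qed
  ultimately show ?thesis using that by blast
qed

lemma det_weighted_gram_bounds:
  assumes fin: "finite E" and w: "\<And>e. e \<in> E \<Longrightarrow> w e \<ge> 0"
  shows "(\<Prod>k<n. \<Sum>e | e \<in> E \<and> (\<forall>t<k. u e t = 0). w e * (u e k)\<^sup>2) \<le> det (weighted_gram E w u n)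
    \<and> det (weighted_gram E w u n) \<le> (\<Prod>k<n. \<Sum>e\<in>E. w e * (u e k)\<^sup>2)"
proof (induction n)
  case 0
  show ?case by (simp add: weighted_gram_def)
next
  case (Suc n)
  define lo where "lo k = (\<Sum>e | e \<in> E \<and> (\<forall>t<k. u e t = 0). w e * (u e k)\<^sup>2)" for k
  define up where "up k = (\<Sum>e\<in>E. w e * (u e k)\<^sup>2)" for k
  have lo: "0 \<le> lo k" and up: "0 \<le> up k" for k
    using w by (auto simp: lo_def up_def intro!: sum_nonneg)
  have IH: "prod lo {..<n} \<le> det (weighted_gram E w u n)" "det (weighted_gram E w u n) \<le> prod up {..<n}"
    using Suc by (simp_all add: lo_def up_def)
  have lon: "0 \<le> prod lo {..<n}" and upn: "0 \<le> prod up {..<n}"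
    using lo up by (auto intro: prod_nonneg)
  have "prod lo {..<Suc n} \<le> det (weighted_gram E w u (Suc n)) \<and>
      det (weighted_gram E w u (Suc n)) \<le> prod up {..<Suc n}"
  proof (cases "det (weighted_gram E w u n) = 0")
    case True
    \<comment> \<open>The lower product lies between \<open>0\<close> and the vanishing
      determinant.\<close>
    then have "prod lo {..<n} = 0" using IH lon by linarith
    then have "prod lo {..<Suc n} = 0" by simp
    then show ?thesis
      using det_weighted_gram_Suc_eq_0[OF fin w True] up upn by (simp only: prod.lessThan_Suc) auto
  next
    case False
    obtain s where s: "det (weighted_gram E w u (Suc n)) = det (weighted_gram E w u n) * s"
      and slo: "lo n \<le> s" and sup: "s \<le> up n"
      by (rule det_weighted_gram_Suc[OF fin w False]) (simp_all only: lo_def up_def)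
    have "prod lo {..<n} * lo n \<le> det (weighted_gram E w u n) * s"
      using IH(1) slo lon lo[of n] by (intro mult_mono) linarith+
    moreover have "det (weighted_gram E w u n) * s \<le> prod up {..<n} * up n"
      using IH slo sup lon upn lo[of n] by (intro mult_mono) linarith+
    ultimately show ?thesis unfolding s prod.lessThan_Suc by simp
  qed
  then show ?case by (simp add: lo_def up_def)
qed

section \<open>Sorting the indices by a permutation\<close>

text \<open>Rows and columns each contribute the sign of \<open>p\<close>, and the signs cancel.
  Columns are treated as rows of the transpose.\<close>

lemma det_permute_rows_columns:
  fixes a :: "nat \<Rightarrow> nat \<Rightarrow> 'a :: comm_ring_1"
  assumes p: "p permutes {0..<n}"
  shows "det (mat n n (\<lambda>(i, j). a (p i) (p j))) = det (mat n n (\<lambda>(i, j). a i j))"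
proof -
  define B where "B = mat n n (\<lambda>(i, j). a i (p j))"
  have pn: "p i < n \<longleftrightarrow> i < n" for i using permutes_in_image[OF p, of i] by simp
  have "mat n n (\<lambda>(i, j). a (p i) (p j)) = mat n n (\<lambda>(i, j). B $$ (p i, j))"
    by (intro eq_matI) (auto simp: B_def pn)
  moreover have "det (mat n n (\<lambda>(i, j). B $$ (p i, j))) = signof p * det B"
    by (rule det_permute_rows[OF _ p]) (simp add: B_def)
  moreover have "det B = det (transpose_mat B)"
    using det_transpose[of B n] by (simp add: B_def)
  moreover have "transpose_mat B = mat n n (\<lambda>(i, j). mat n n (\<lambda>(i, j). a j i) $$ (p i, j))"
    by (intro eq_matI) (auto simp: B_def pn)
  moreover have "det \<dots> = signof p * det (mat n n (\<lambda>(i, j). a j i))"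
    by (rule det_permute_rows[OF _ p]) simp
  moreover have "det (mat n n (\<lambda>(i, j). a j i)) = det (transpose_mat (mat n n (\<lambda>(i, j). a i j)))"
    by (rule arg_cong[of _ _ det], intro eq_matI) auto
  moreover have "\<dots> = det (mat n n (\<lambda>(i, j). a i j))"
    by (rule det_transpose[of _ n]) simp
  moreover have "signof p * (signof p * z) = z" for z :: 'a
    by (simp add: sign_def)
  ultimately show ?thesis by simp
qed

lemma obtain_sorting_permutation:
  fixes x :: "nat \<Rightarrow> 'a :: wellorder"
  assumes inj: "inj_on x {..<n}"
  obtains p where "p permutes {..<n}" and "strict_mono_on {..<n} (x \<circ> p)"
proof -
  obtain y where y: "bij_betw y {..<n} (x ` {..<n})" "strict_mono_on {..<n} y"
    using ex_bij_betw_strict_mono_card[of "x ` {..<n}"] card_image[OF inj] by auto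
  \<comment> \<open>Position \<open>i\<close> receives the index of the i-th smallest value. Outside
    the range \<open>p\<close> is the identity, as \<open>permutes\<close> demands.\<close>
  define p where "p i = (if i < n then inv_into {..<n} x (y i) else i)" for i
  have xp: "x (p i) = y i" if "i < n" for i
    using that y(1) by (auto simp: p_def bij_betw_def intro!: f_inv_into_f)
  have "bij_betw (inv_into {..<n} x \<circ> y) {..<n} {..<n}"
    using y(1) inj by (auto intro: bij_betw_trans bij_betw_inv_into bij_betw_imageI)
  then have "bij_betw p {..<n} {..<n}"
    by (rule iffD1[OF bij_betw_cong, rotated]) (simp add: p_def)
  then have "p permutes {..<n}"
    by (rule bij_imp_permutes) (simp add: p_def)
  moreover have "strict_mono_on {..<n} (x \<circ> p)"
    using y(2) by (auto simp: strict_mono_on_def xp)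
  ultimately show ?thesis using that by blast
qed

section \<open>Positive semi-definiteness\<close>

text \<open>The Hermitian form at \<open>v\<close> is the sum of \<open>w e\<close> times the
  squared modulus of \<open>q e\<close>, where \<open>q e\<close> pairs \<open>v\<close> with the
  real vector \<open>u e\<close>.\<close>

lemma psd_mat_weighted_gram:
  assumes w: "\<And>e. e \<in> E \<Longrightarrow> w e \<ge> 0"
  shows "psd_mat (map_mat complex_of_real (weighted_gram E w u n))"
proof -
  let ?A = "map_mat complex_of_real (weighted_gram E w u n)"
  have A: "?A \<in> carrier_mat n n" by simp
  have "mat_adjoint ?A = ?A"
    by (intro eq_matI) (auto simp: mat_adjoint_def mat_of_rows_def weighted_gram_def mult_ac)
  moreover have "0 \<le> (?A *\<^sub>v v) \<bullet>c v" if v: "v \<in> carrier_vec n" for v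
  proof -
    define q where "q e = (\<Sum>i<n. of_real (u e i) * v $ i)" for e
    have "(?A *\<^sub>v v) \<bullet>c v
        = (\<Sum>i<n. (\<Sum>j<n. (\<Sum>e\<in>E. of_real (w e * u e i * u e j)) * v $ j) * cnj (v $ i))"
      using v by (simp add: scalar_prod_def weighted_gram_def atLeast0LessThan)
    also have "\<dots> = (\<Sum>i<n. \<Sum>e\<in>E. of_real (w e * u e i) * q e * cnj (v $ i))"
      unfolding q_def sum_distrib_right sum_distrib_left
      by (intro sum.cong refl, subst sum.swap) (simp add: mult_ac)
    also have "\<dots> = (\<Sum>e\<in>E. of_real (w e) * (q e * cnj (q e)))"
      by (subst sum.swap) (simp add: q_def sum_distrib_left mult_ac)
    also have "\<dots> = (\<Sum>e\<in>E. of_real (w e * (cmod (q e))\<^sup>2))"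
      by (simp add: complex_norm_square[symmetric] del: complex_norm_square)
    also have "0 \<le> \<dots>"
      using w by (intro sum_nonneg) (simp add: less_eq_complex_def)
    finally show ?thesis .
  qed
  ultimately show ?thesis by (simp add: psd_mat_def weighted_gram_def)
qed

section \<open>Gcd matrices as weighted Gram matrices\<close>

theorem theorem1p2:
  fixes c d n :: nat
    and x :: "nat \<Rightarrow> nat"
    and f :: "nat \<Rightarrow> nat \<Rightarrow> complex"
    and l :: "nat \<Rightarrow> nat"
    and F h :: "nat \<Rightarrow> complex"
  assumes "c \<ge> 1"
    and "\<And>i. i < n \<Longrightarrow> x i > 0"
    and "inj_on x {..<n}"
    and "\<And>i. i < c \<Longrightarrow> f i \<in> class_C (x ` {..<n})"
    and "\<And>i j. i < c \<Longrightarrow> j < c \<Longrightarrow> i \<noteq> j \<Longrightarrow> \<not> arith_eq (f i) (f j)"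
    and "\<And>i. i < c \<Longrightarrow> l i > 0"
    and "(\<Sum>i<c. l i) > d"
    and "F = dconv_prod (\<lambda>i. dconv_pow (f i) (l i)) c"
    and "h = F \<star> dconv_pow moebius d"
  shows "(det (gcd_mat h n x) \<in> \<real> \<and>
       (\<Prod>k<n. \<Sum>e | e dvd x k \<and> (\<forall>t<n. x t < x k \<longrightarrow> \<not> e dvd x t).
           (F \<star> dconv_pow moebius (d + 1)) e)
         \<le> det (gcd_mat h n x) \<and>
       det (gcd_mat h n x) \<le> (\<Prod>k<n. h (x k))) \<and>
      psd_mat (gcd_mat h n x)"
proof -
  define g where "g = h \<star> moebius"
  define D where "D = {e. \<exists>z\<in>x ` {..<n}. e dvd z}"
  define w where "w e = Re (g e)" for e
  have x0: "0 \<notin> x ` {..<n}" using assms(2) by force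
  have g: "g = F \<star> dconv_pow moebius (d + 1)"
    by (simp add: g_def assms(9) dconv_assoc)
  have D: "\<forall>e\<in>D. \<forall>a. a dvd e \<longrightarrow> a \<in> D"
    by (auto simp: D_def dest: dvd_trans)
  have "moebius_nonneg D (l i) (dconv_pow (f i) (l i))" if "i < c" for i
    by (rule moebius_nonneg_dconv_pow
        [OF D moebius_nonneg_class_C[OF assms(4)[OF that] x0, folded D_def]])
  then have "moebius_nonneg D (\<Sum>i<c. l i) F"
    unfolding assms(8) by (rule moebius_nonneg_dconv_prod[OF D])
  \<comment> \<open>The \<open>d\<close> factors \<mu> in \<open>h\<close> and the extra one from
    Moebius inversion fit within the total capacity of \<open>F\<close>.\<close>
  moreover have "d + 1 \<le> (\<Sum>i<c. l i)" using assms(7) by linarith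
  ultimately have g_nonneg: "0 \<le> g e" if "e \<in> D" for e
    unfolding g moebius_nonneg_def using that by blast
  have w: "0 \<le> w e" and gw: "g e = of_real (w e)" if "e \<in> D" for e
    using g_nonneg[OF that] by (simp_all add: w_def less_eq_complex_def complex_eq_iff)
  have D_eq: "D = (\<Union>k<n. {e. e dvd x k})" by (auto simp: D_def)
  have finD: "finite D" unfolding D_eq using assms(2) by auto
  \<comment> \<open>The divisors of a gcd are the common divisors, which the product of two
    indicators selects. A general \<open>y\<close> serves both the given order and the sorted
    one.\<close>
  have h_eq: "h (gcd (y i) (y j)) = of_real (\<Sum>e\<in>D. w e * of_bool (e dvd y i) * of_bool (e dvd y j))"
    if "y i \<in> x ` {..<n}" "y j \<in> x ` {..<n}" for y :: "nat \<Rightarrow> nat" and i j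
  proof -
    have "gcd (y i) (y j) > 0" using that x0 by (metis gcd_pos_nat gr0I)
    then have "h (gcd (y i) (y j)) = (\<Sum>e | e dvd gcd (y i) (y j). g e)"
      unfolding g_def by (rule sum_dconv_moebius[symmetric])
    also have "\<dots> = (\<Sum>e\<in>D. if e dvd y i \<and> e dvd y j then g e else 0)"
      using that by (subst sum.inter_filter[OF finD, symmetric])
        (auto simp: D_def intro!: sum.cong)
    also have "\<dots> = of_real (\<Sum>e\<in>D. w e * of_bool (e dvd y i) * of_bool (e dvd y j))"
      by (auto simp: gw intro!: sum.cong)
    finally show ?thesis .
  qed
  have gram: "gcd_mat h n y = map_mat of_real (weighted_gram D w (\<lambda>e i. of_bool (e dvd y i)) n)"
    if "\<And>i. i < n \<Longrightarrow> y i \<in> x ` {..<n}" for y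
    by (intro eq_matI) (auto simp: gcd_mat_def weighted_gram_def h_eq that)
  \<comment> \<open>Sorting turns the condition \<open>x t < x k\<close> of the lower bound into
    precedence of indices, the form used by the determinant bounds.\<close>
  obtain p where p: "p permutes {..<n}" and mono: "strict_mono_on {..<n} (x \<circ> p)"
    using obtain_sorting_permutation[OF assms(3)] by blast
  have pn: "p i < n \<longleftrightarrow> i < n" for i using permutes_in_image[OF p, of i] by simp
  have xp: "x (p i) \<in> x ` {..<n}" if "i < n" for i using that by (simp add: pn)
  have in_D: "e \<in> D" if "i < n" "e dvd x (p i)" for i e
    using xp[OF that(1)] that(2) unfolding D_def by blast
  define G where "G = weighted_gram D w (\<lambda>e i. of_bool (e dvd x (p i))) n"
  have "det (gcd_mat h n x) = det (gcd_mat h n (x \<circ> p))"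
    using det_permute_rows_columns[of p n "\<lambda>i j. h (gcd (x i) (x j))"] p
    by (simp add: gcd_mat_def atLeast0LessThan)
  also have "gcd_mat h n (x \<circ> p) = map_mat of_real G"
    using gram[of "x \<circ> p"] xp by (simp add: G_def)
  finally have det_eq: "det (gcd_mat h n x) = of_real (det G)" by simp
  \<comment> \<open>The right-hand side is phrased with \<open>of_bool\<close> and a zero test to be
    literally the lower bound for the weighted Gram matrix \<open>G\<close>.\<close>
  have lower: "(\<Prod>k<n. \<Sum>e | e dvd x k \<and> (\<forall>t<n. x t < x k \<longrightarrow> \<not> e dvd x t).
        (F \<star> dconv_pow moebius (d + 1)) e)
      = of_real (\<Prod>k<n. \<Sum>e | e \<in> D \<and> (\<forall>t<k. of_bool (e dvd x (p t)) = (0 :: real)).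
          w e * (of_bool (e dvd x (p k)))\<^sup>2)"
  proof -
    have "(\<Prod>k<n. \<Sum>e | e dvd x k \<and> (\<forall>t<n. x t < x k \<longrightarrow> \<not> e dvd x t). g e)
        = (\<Prod>k<n. \<Sum>e | e dvd x (p k) \<and> (\<forall>t<n. x t < x (p k) \<longrightarrow> \<not> e dvd x t). g e)"
      using prod.permute[OF p] by (simp add: comp_def)
    also have "\<dots> = (\<Prod>k<n. of_real (\<Sum>e | e \<in> D \<and> (\<forall>t<k. of_bool (e dvd x (p t)) = (0 :: real)).
          w e * (of_bool (e dvd x (p k)))\<^sup>2))"
    proof (intro prod.cong refl)
      fix k assume "k \<in> {..<n}"
      then have k: "k < n" by simp
      have less: "x (p t) < x (p k) \<longleftrightarrow> t < k" if "t < n" for t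
        using strict_mono_on_less[OF mono] that k by simp
      have iff: "(\<forall>t<n. x t < x (p k) \<longrightarrow> \<not> e dvd x t) \<longleftrightarrow> (\<forall>t<k. \<not> e dvd x (p t))" for e
      proof -
        have "(\<forall>t<n. x t < x (p k) \<longrightarrow> \<not> e dvd x t)
            \<longleftrightarrow> (\<forall>t\<in>p ` {..<n}. x t < x (p k) \<longrightarrow> \<not> e dvd x t)"
          unfolding permutes_image[OF p] by blast
        also have "\<dots> \<longleftrightarrow> (\<forall>t<k. \<not> e dvd x (p t))"
          using k by (auto simp: less dest: order.strict_trans)
        finally show ?thesis .
      qed
      \<comment> \<open>Enlarging the index set to elements of \<open>D\<close> that do not divide
        \<open>x (p k)\<close> only adds terms killed by the indicator.\<close>
      have "(\<Sum>e | e dvd x (p k) \<and> (\<forall>t<k. \<not> e dvd x (p t)). g e)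
          = (\<Sum>e | e \<in> D \<and> (\<forall>t<k. \<not> e dvd x (p t)). of_real (w e * (of_bool (e dvd x (p k)))\<^sup>2))"
        using finD in_D[OF k] by (intro sum.mono_neutral_cong_left) (auto simp: gw)
      then show "(\<Sum>e | e dvd x (p k) \<and> (\<forall>t<n. x t < x (p k) \<longrightarrow> \<not> e dvd x t). g e)
          = of_real (\<Sum>e | e \<in> D \<and> (\<forall>t<k. of_bool (e dvd x (p t)) = (0 :: real)).
          w e * (of_bool (e dvd x (p k)))\<^sup>2)"
        by (simp add: iff)
    qed
    finally show ?thesis by (simp add: g)
  qed
  have upper: "(\<Prod>k<n. h (x k)) = of_real (\<Prod>k<n. \<Sum>e\<in>D. w e * (of_bool (e dvd x (p k)))\<^sup>2)"
  proof -
    have "(\<Prod>k<n. h (x k)) = (\<Prod>k<n. h (x (p k)))"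
      using prod.permute[OF p] by (simp add: comp_def)
    also have "\<dots> = (\<Prod>k<n. of_real (\<Sum>e\<in>D. w e * (of_bool (e dvd x (p k)))\<^sup>2))"
    proof (intro prod.cong refl)
      fix k assume "k \<in> {..<n}"
      then show "h (x (p k)) = of_real (\<Sum>e\<in>D. w e * (of_bool (e dvd x (p k)))\<^sup>2)"
        \<comment> \<open>A diagonal entry is the case of equal indices, where the gcd is
          \<open>x (p k)\<close> itself.\<close>
        using h_eq[of "\<lambda>i. x (p i)" k k] xp[of k] by (simp add: power2_eq_square mult.assoc)
    qed
    finally show ?thesis by simp
  qed
  have real_le: "complex_of_real a \<le> of_real b \<longleftrightarrow> a \<le> b" for a b
    by (simp add: less_eq_complex_def)
  have "psd_mat (gcd_mat h n x)"
    using psd_mat_weighted_gram[OF w] gram[of x] by simp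
  moreover have
    "(\<Prod>k<n. \<Sum>e | e \<in> D \<and> (\<forall>t<k. of_bool (e dvd x (p t)) = (0 :: real)).
        w e * (of_bool (e dvd x (p k)))\<^sup>2) \<le> det G
      \<and> det G \<le> (\<Prod>k<n. \<Sum>e\<in>D. w e * (of_bool (e dvd x (p k)))\<^sup>2)"
    unfolding G_def by (rule det_weighted_gram_bounds[OF finD]) (rule w)
  ultimately show ?thesis
    unfolding det_eq lower upper real_le using Reals_of_real by blast
qed

end
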